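(* There exist a commutative ring $R$, an ideal $\mathfrak{a}\subseteq R$, and an $R$-module $M$ such that $M$ is weakly $\mathfrak{a}$-quasifair, but neither $\mathfrak{a}$-fair nor weakly $\mathfrak{a}$-fair.
   Context: Rings are commutative with unit. $\mathrm{Var}(\mathfrak{a})$ is the set of prime ideals of $R$ containing $\mathfrak{a}$, and $\Gamma_{\mathfrak{a}}(M)=\{x\in M\mid\exists n\in\mathbb{N}:\mathfrak{a}^nx=0\}$. For $x\in M$, $(0:_Rx)=\{r\in R\mid rx=0\}$. The assassin $\mathrm{Ass}_R(M)$ is the set of prime ideals of $R$ of the form $(0:_Rx)$ for some $x\in M$. The weak assassin $\mathrm{Ass}^{\rm f}_R(M)$ is the set of prime ideals $\mathfrak{p}$ of $R$ such that there exists $x\in M$ for which $\mathfrak{p}$ is minimal (with respect to inclusion) among the prime ideals containing $(0:_Rx)$. The $R$-module $M$ is called $\mathfrak{a}$-fair if $\mathrm{Ass}_R(M/\Gamma_{\mathfrak{a}}(M))=\mathrm{Ass}_R(M)\setminus\mathrm{Var}(\mathfrak{a})$; weakly $\mathfrak{a}$-quasifair if $\mathrm{Ass}^{\rm f}_R(\Gamma_{\mathfrak{a}}(M))=\mathrm{Ass}^{\rm f}_R(M)\cap\mathrm{Var}(\mathfrak{a})$; and weakly $\mathfrak{a}$-fair if $\mathrm{Ass}^{\rm f}_R(M/\Gamma_{\mathfrak{a}}(M))=\mathrm{Ass}^{\rm f}_R(M)\setminus\mathrm{Var}(\mathfrak{a})$. *)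

theory Defs
  imports "HOL-Algebra.Module" "HOL-Algebra.AbelCoset" "HOL-Algebra.Ideal_Product"
begin

definition Var :: "('a, 'm) ring_scheme \<Rightarrow> 'a set \<Rightarrow> 'a set set"
  where "Var R \<aa> = {\<pp>. primeideal \<pp> R \<and> \<aa> \<subseteq> \<pp>}"

text \<open>Powers of an ideal are its powers in the multiplicative monoid of ideals; the zeroth
  power is the whole ring.\<close>

definition torsion ::
    "('a, 'm) ring_scheme \<Rightarrow> 'a set \<Rightarrow> ('a, 'b, 'n) module_scheme \<Rightarrow> 'b set"
  where "torsion R \<aa> M =
    {x \<in> carrier M. \<exists>n::nat. \<forall>r \<in> \<aa> [^]\<^bsub>ideals_set R\<^esub> n. r \<odot>\<^bsub>M\<^esub> x = \<zero>\<^bsub>M\<^esub>}"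

definition ann :: "('a, 'm) ring_scheme \<Rightarrow> ('a, 'b, 'n) module_scheme \<Rightarrow> 'b \<Rightarrow> 'a set"
  where "ann R M x = {r \<in> carrier R. r \<odot>\<^bsub>M\<^esub> x = \<zero>\<^bsub>M\<^esub>}"

definition Ass :: "('a, 'm) ring_scheme \<Rightarrow> ('a, 'b, 'n) module_scheme \<Rightarrow> 'a set set"
  where "Ass R M = {\<pp>. primeideal \<pp> R \<and> (\<exists>x \<in> carrier M. \<pp> = ann R M x)}"

definition weak_Ass :: "('a, 'm) ring_scheme \<Rightarrow> ('a, 'b, 'n) module_scheme \<Rightarrow> 'a set set"
  where "weak_Ass R M =
    {\<pp>. \<exists>x \<in> carrier M. \<pp> \<in> Var R (ann R M x) \<and>
          (\<forall>\<qq> \<in> Var R (ann R M x). \<qq> \<subseteq> \<pp> \<longrightarrow> \<qq> = \<pp>)}"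

text \<open>The module record extends the ring record, so the fields \<open>mult\<close> and \<open>one\<close> are present
  but carry no information for a module.\<close>

definition quotient_module ::
    "('a, 'b, 'n) module_scheme \<Rightarrow> 'b set \<Rightarrow> ('a, 'b set) module"
  where "quotient_module M N =
    \<lparr>carrier = a_rcosets\<^bsub>M\<^esub> N, mult = undefined, one = undefined,
      zero = N, add = set_add M,
      smult = (\<lambda>r C. \<Union>c\<in>C. N +>\<^bsub>M\<^esub> (r \<odot>\<^bsub>M\<^esub> c))\<rparr>"

lemma (in module) quotient_smult:
  assumes N: "submodule N R M" and r: "r \<in> carrier R" and x: "x \<in> carrier M"
  shows "r \<odot>\<^bsub>quotient_module M N\<^esub> (N +>\<^bsub>M\<^esub> x) = N +>\<^bsub>M\<^esub> (r \<odot>\<^bsub>M\<^esub> x)"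
proof -
  interpret N: submodule N R M by (rule N)
  have sg: "subgroup N (add_monoid M)" by (rule N.subgroup_axioms)
  have sub: "N \<subseteq> carrier M" using N.subset by simp
  have "N +>\<^bsub>M\<^esub> (r \<odot>\<^bsub>M\<^esub> c) = N +>\<^bsub>M\<^esub> (r \<odot>\<^bsub>M\<^esub> x)" if c: "c \<in> N +>\<^bsub>M\<^esub> x" for c
  proof -
    obtain n where n: "n \<in> N" "c = n \<oplus>\<^bsub>M\<^esub> x"
      using c by (auto simp: a_r_coset_def')
    have "r \<odot>\<^bsub>M\<^esub> c = r \<odot>\<^bsub>M\<^esub> n \<oplus>\<^bsub>M\<^esub> r \<odot>\<^bsub>M\<^esub> x"
      using n(2) smult_r_distr[OF r subsetD[OF sub n(1)] x] by simp
    moreover have "r \<odot>\<^bsub>M\<^esub> n \<in> N" using N.smult_closed r n by simp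
    ultimately have "r \<odot>\<^bsub>M\<^esub> c \<in> N +>\<^bsub>M\<^esub> (r \<odot>\<^bsub>M\<^esub> x)"
      by (auto simp: a_r_coset_def')
    then show ?thesis
      by (rule M.a_repr_independence[OF _ smult_closed[OF r x] sg, symmetric])
  qed
  moreover have "x \<in> N +>\<^bsub>M\<^esub> x"
    using subgroup.one_closed[OF sg] x by (auto simp: a_r_coset_def' intro!: bexI[of _ "\<zero>\<^bsub>M\<^esub>"])
  ultimately have "(\<Union>c \<in> N +>\<^bsub>M\<^esub> x. N +>\<^bsub>M\<^esub> (r \<odot>\<^bsub>M\<^esub> c)) = N +>\<^bsub>M\<^esub> (r \<odot>\<^bsub>M\<^esub> x)"
    by (intro UN_constant_eq ballI)
  then show ?thesis
    by (simp add: quotient_module_def)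
qed

lemma (in module) quotient_is_module:
  assumes N: "submodule N R M"
  shows "module R (quotient_module M N)"
proof -
  interpret N: submodule N R M by (rule N)
  have sg: "subgroup N (add_monoid M)" by (rule N.subgroup_axioms)
  interpret A: abelian_subgroup N M
    by (rule abelian_subgroupI3)
      (auto simp: additive_subgroup_def sg M.abelian_group_axioms)
  let ?Q = "quotient_module M N"
  have car: "C \<in> carrier ?Q \<longleftrightarrow> (\<exists>x\<in>carrier M. C = N +>\<^bsub>M\<^esub> x)" for C
    by (auto simp: quotient_module_def A_RCOSETS_def')
  have add: "(N +>\<^bsub>M\<^esub> x) \<oplus>\<^bsub>?Q\<^esub> (N +>\<^bsub>M\<^esub> y) = N +>\<^bsub>M\<^esub> (x \<oplus>\<^bsub>M\<^esub> y)"
    if "x \<in> carrier M" "y \<in> carrier M" for x y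
    using that by (simp add: quotient_module_def A.a_rcos_sum)
  note sm = quotient_smult[OF N]
  have zero: "\<zero>\<^bsub>?Q\<^esub> = N +>\<^bsub>M\<^esub> \<zero>\<^bsub>M\<^esub>"
    using N.subset by (simp add: quotient_module_def)
  have grp: "abelian_group ?Q"
  proof (rule abelian_groupI)
    fix C assume "C \<in> carrier ?Q"
    then obtain x where x: "x \<in> carrier M" "C = N +>\<^bsub>M\<^esub> x" by (auto simp: car)
    then have "N +>\<^bsub>M\<^esub> (\<ominus>\<^bsub>M\<^esub> x) \<in> carrier ?Q"
      "(N +>\<^bsub>M\<^esub> (\<ominus>\<^bsub>M\<^esub> x)) \<oplus>\<^bsub>?Q\<^esub> C = \<zero>\<^bsub>?Q\<^esub>"
      by (auto simp: car add zero M.l_neg)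
    then show "\<exists>D\<in>carrier ?Q. D \<oplus>\<^bsub>?Q\<^esub> C = \<zero>\<^bsub>?Q\<^esub>" by blast
  qed (auto simp: car add zero M.a_ac)
  show ?thesis
  proof (rule moduleI)
    show "cring R" by (rule is_cring)
    show "abelian_group ?Q" by (rule grp)
  next
    fix a C assume "a \<in> carrier R" "C \<in> carrier ?Q"
    then show "a \<odot>\<^bsub>?Q\<^esub> C \<in> carrier ?Q" by (auto simp: car sm)
  next
    fix a b C assume "a \<in> carrier R" "b \<in> carrier R" "C \<in> carrier ?Q"
    then show "(a \<oplus> b) \<odot>\<^bsub>?Q\<^esub> C = (a \<odot>\<^bsub>?Q\<^esub> C) \<oplus>\<^bsub>?Q\<^esub> (b \<odot>\<^bsub>?Q\<^esub> C)"
      by (auto simp: car sm add smult_l_distr)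
  next
    fix a C D assume "a \<in> carrier R" "C \<in> carrier ?Q" "D \<in> carrier ?Q"
    then show "a \<odot>\<^bsub>?Q\<^esub> (C \<oplus>\<^bsub>?Q\<^esub> D) = (a \<odot>\<^bsub>?Q\<^esub> C) \<oplus>\<^bsub>?Q\<^esub> (a \<odot>\<^bsub>?Q\<^esub> D)"
      by (auto simp: car sm add smult_r_distr)
  next
    fix a b C assume "a \<in> carrier R" "b \<in> carrier R" "C \<in> carrier ?Q"
    then show "(a \<otimes> b) \<odot>\<^bsub>?Q\<^esub> C = a \<odot>\<^bsub>?Q\<^esub> (b \<odot>\<^bsub>?Q\<^esub> C)"
      by (auto simp: car sm smult_assoc1)
  next
    fix C assume "C \<in> carrier ?Q"
    then show "\<one> \<odot>\<^bsub>?Q\<^esub> C = C" by (auto simp: car sm)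
  qed
qed

definition fair :: "('a, 'm) ring_scheme \<Rightarrow> 'a set \<Rightarrow> ('a, 'b, 'n) module_scheme \<Rightarrow> bool"
  where "fair R \<aa> M \<longleftrightarrow>
    Ass R (quotient_module M (torsion R \<aa> M)) = Ass R M - Var R \<aa>"

definition weakly_quasifair ::
    "('a, 'm) ring_scheme \<Rightarrow> 'a set \<Rightarrow> ('a, 'b, 'n) module_scheme \<Rightarrow> bool"
  where "weakly_quasifair R \<aa> M \<longleftrightarrow>
    weak_Ass R (M\<lparr>carrier := torsion R \<aa> M\<rparr>) = weak_Ass R M \<inter> Var R \<aa>"

definition weakly_fair ::
    "('a, 'm) ring_scheme \<Rightarrow> 'a set \<Rightarrow> ('a, 'b, 'n) module_scheme \<Rightarrow> bool"
  where "weakly_fair R \<aa> M \<longleftrightarrow>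
    weak_Ass R (quotient_module M (torsion R \<aa> M)) = weak_Ass R M - Var R \<aa>"

end

theory Submission
  imports "HOL-Library.Z2" "HOL-Library.Nat_Bijection"
    "HOL-Computational_Algebra.Formal_Power_Series" "HOL-Algebra.Weak_Morphisms" Defs
begin

text \<open>The example is a local ring \<open>R\<close> with maximal ideal \<open>\<mm>\<close>, regarded as a module over itself,
  such that every element of \<open>\<mm>\<close> is killed by some power of \<open>\<mm>\<close>, while no power of \<open>\<mm>\<close> is zero.
  The first property makes \<open>\<mm>\<close> nil, so \<open>\<mm>\<close> is the only prime ideal of \<open>R\<close>
  (\<open>primeideal_iff_max\<close>) and the weak assassin of every nonzero module is \<open>{\<mm>}\<close>.
  Together the two properties give \<open>\<Gamma>\<^sub>\<mm>(R) = \<mm>\<close> (\<open>torsion_regular_eq_max\<close>), since a unit is killed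
  by no power of \<open>\<mm>\<close>. Hence \<open>\<Gamma>\<^sub>\<mm>(R)\<close> and \<open>R\<close> have the same weak assassin \<open>{\<mm>} = Var(\<mm>)\<close>,
  which is weak quasifairness. But \<open>R/\<Gamma>\<^sub>\<mm>(R) = R/\<mm>\<close> has assassin and weak assassin \<open>{\<mm>}\<close>, whereas
  removing \<open>Var(\<mm>)\<close> from the assassin or the weak assassin of \<open>R\<close> leaves nothing. The torsion
  functor fails to be a radical here: \<open>\<mm>\<close> kills \<open>R/\<mm>\<close>, but no single power of \<open>\<mm>\<close> kills \<open>\<mm>\<close>.

  Such a ring is obtained by gluing the rings \<open>F[t]/(t\<^sup>n\<^sup>+\<^sup>1)\<close>, for \<open>F\<close> the field with two elements,
  along their residue fields: it consists of the sequences with a common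
  constant term \<open>c\<close> that are equal to \<open>c\<close> in all but finitely many components. An element of the
  maximal ideal (\<open>c = 0\<close>) lives on finitely many components, where
  a large power of \<open>t\<close> is zero (\<open>trunc_max_killed\<close>); yet \<open>t\<^sup>n\<close> is nonzero in the component of
  index \<open>n\<close> (\<open>trunc_max_pow_nonzero\<close>). As \<open>F\<close> has two elements, a sequence of truncated
  power series is determined by the set of places where its coefficients are \<open>1\<close>, so the ring can be
  realised on sets of natural numbers.\<close>

section \<open>Powers of an ideal\<close>

lemma ideals_set_simps [simp]:
  "\<one>\<^bsub>ideals_set R\<^esub> = carrier R" "\<aa> \<otimes>\<^bsub>ideals_set R\<^esub> \<bb> = ideal_prod R \<aa> \<bb>"
  by (simp_all add: ideals_set_def)

lemma (in ring) pow_in_ideal_pow: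
  assumes "x \<in> \<aa>"
  shows "x [^] n \<in> \<aa> [^]\<^bsub>ideals_set R\<^esub> (n::nat)"
  by (induction n) (simp_all add: assms ideal_prod.prod)

lemma (in primeideal) pow_mem_imp_mem:
  assumes "x \<in> carrier R" "x [^] (n::nat) \<in> I"
  shows "x \<in> I"
  using assms(2)
proof (induction n)
  case 0
  then show ?case using one_imp_carrier I_notcarr by auto
next
  case (Suc n)
  then show ?case using I_prime[of "x [^] n" x] assms(1) by auto
qed

section \<open>Local rings with a torsion maximal ideal of unbounded exponent\<close>

definition regular_module :: "('a, 'm) ring_scheme \<Rightarrow> ('a, 'a) module"
  where "regular_module R = \<lparr>carrier = carrier R, mult = mult R, one = one R,
    zero = zero R, add = add R, smult = mult R\<rparr>"

lemma regular_module_simps [simp]: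
  "carrier (regular_module R) = carrier R" "zero (regular_module R) = zero R"
  "add (regular_module R) = add R" "smult (regular_module R) = mult R"
  by (simp_all add: regular_module_def)

lemma (in cring) module_regular_module: "module R (regular_module R)"
proof (rule moduleI)
  show "abelian_group (regular_module R)"
  proof (rule abelian_groupI)
    fix x assume "x \<in> carrier (regular_module R)"
    then show "\<exists>y\<in>carrier (regular_module R). y \<oplus>\<^bsub>regular_module R\<^esub> x = \<zero>\<^bsub>regular_module R\<^esub>"
      using l_neg[of x] by (auto intro: bexI[of _ "\<ominus> x"])
  qed (auto simp: a_ac)
qed (auto simp: is_cring l_distr r_distr m_assoc)

lemma (in ideal) submodule_regular_module:
  assumes "cring R"
  shows "submodule I R (regular_module R)"
proof -
  interpret cring R by fact
  interpret M: module R "regular_module R" by (rule module_regular_module)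
  have inv: "\<ominus>\<^bsub>regular_module R\<^esub> x = \<ominus> x" if "x \<in> carrier R" for x
    using that by (intro M.M.minus_equality) (auto simp: l_neg)
  show ?thesis
  proof (rule M.submoduleI)
    fix x assume "x \<in> I"
    then show "\<ominus>\<^bsub>regular_module R\<^esub> x \<in> I" by (simp add: inv Icarr)
  qed (use a_subset I_l_closed in auto)
qed

text \<open>It matters that the exponents in \<open>killed\<close> are unbounded, which \<open>pow_nonzero\<close> forces: if
  \<open>\<mm>\<^sup>n = 0\<close>, then \<open>R\<close> itself is \<open>\<mm>\<close>-torsion, and both fairness properties hold trivially.\<close>

locale unbounded_torsion_local_ring = cring R + ideal \<mm> R for R (structure) and \<mm> +
  assumes one_notin: "\<one> \<notin> \<mm>"
    and unit: "\<lbrakk>x \<in> carrier R; x \<notin> \<mm>\<rbrakk> \<Longrightarrow> x \<in> Units R"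
    and killed: "x \<in> \<mm> \<Longrightarrow> \<exists>n::nat. \<forall>r \<in> \<mm> [^]\<^bsub>ideals_set R\<^esub> n. r \<otimes> x = \<zero>"
    and pow_nonzero: "\<exists>r \<in> \<mm> [^]\<^bsub>ideals_set R\<^esub> (n::nat). r \<noteq> \<zero>"
begin

lemma ideal_pow_carrier: "\<mm> [^]\<^bsub>ideals_set R\<^esub> (n::nat) \<subseteq> carrier R"
proof -
  have "ideal (\<mm> [^]\<^bsub>ideals_set R\<^esub> n) R"
    by (induction n)
      (simp_all add: oneideal ideal_prod_is_ideal is_ideal)
  then show ?thesis by (meson ideal.Icarr subsetI)
qed

lemma unit_notin: "x \<in> Units R \<Longrightarrow> x \<notin> \<mm>"
  using one_notin I_l_closed[of x "inv x"] by fastforce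

lemma annihilator_of_nonzero_in_max:
  assumes "x \<in> carrier R" "x \<noteq> \<zero>" "r \<in> carrier R" "r \<otimes> x = \<zero>"
  shows "r \<in> \<mm>"
proof (rule ccontr)
  assume "r \<notin> \<mm>"
  then have "r \<in> Units R" using assms unit by blast
  then have "x = \<zero>" using assms Units_l_cancel[of r x \<zero>] by simp
  then show False using assms by blast
qed

text \<open>A prime ideal contains no units, hence lies in \<open>\<mm>\<close>, and it contains all nilpotent elements,
  hence all of \<open>\<mm>\<close>: if \<open>\<mm>\<^sup>n\<close> kills \<open>x \<in> \<mm>\<close>, it does so in particular with \<open>x\<^sup>n\<close>.\<close>

lemma primeideal_iff_max: "primeideal \<pp> R \<longleftrightarrow> \<pp> = \<mm>"
proof
  assume "primeideal \<pp> R"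
  then interpret P: primeideal \<pp> R .
  have "x \<in> \<mm>" if "x \<in> \<pp>" for x
  proof (rule ccontr)
    assume "x \<notin> \<mm>"
    then have "x \<in> Units R" using that unit by (simp add: P.Icarr)
    then have "\<one> \<in> \<pp>" using P.I_l_closed[OF that, of "inv x"] by simp
    then show False using P.one_imp_carrier P.I_notcarr by simp
  qed
  moreover have "x \<in> \<pp>" if mem: "x \<in> \<mm>" for x
  proof -
    have x: "x \<in> carrier R" using mem Icarr by simp
    obtain n :: nat where "\<forall>r \<in> \<mm> [^]\<^bsub>ideals_set R\<^esub> n. r \<otimes> x = \<zero>"
      using killed[OF mem] by blast
    then have "x [^] Suc n = \<zero>" using pow_in_ideal_pow[OF mem, of n] by simp
    then show ?thesis using P.pow_mem_imp_mem[OF x, of "Suc n"] by (simp del: nat_pow_Suc)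
  qed
  ultimately show "\<pp> = \<mm>" by blast
next
  have "primeideal \<mm> R"
  proof (rule primeidealI)
    show "carrier R \<noteq> \<mm>" using one_notin by auto
  next
    fix a b assume "a \<in> carrier R" "b \<in> carrier R" "a \<otimes> b \<in> \<mm>"
    then show "a \<in> \<mm> \<or> b \<in> \<mm>" using unit unit_notin Units_m_closed by blast
  qed (simp_all add: is_ideal is_cring)
  then show "primeideal \<pp> R" if "\<pp> = \<mm>" using that by simp
qed

lemma Var_max: "Var R \<mm> = {\<mm>}"
  by (auto simp: Var_def primeideal_iff_max)

lemma weak_Ass_eq_max:
  assumes "x \<in> carrier N" "ann R N x \<subseteq> \<mm>"
  shows "weak_Ass R N = {\<mm>}"
  using assms by (auto simp: weak_Ass_def Var_def primeideal_iff_max)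

text \<open>An element outside \<open>\<mm>\<close> is a unit; if \<open>\<mm>\<^sup>n\<close> killed it, then \<open>\<mm>\<^sup>n\<close> would be zero.\<close>

lemma torsion_regular_eq_max: "torsion R \<mm> (regular_module R) = \<mm>"
proof
  show "torsion R \<mm> (regular_module R) \<subseteq> \<mm>"
  proof
    fix x assume "x \<in> torsion R \<mm> (regular_module R)"
    then obtain n :: nat where x: "x \<in> carrier R"
      and n: "\<forall>r \<in> \<mm> [^]\<^bsub>ideals_set R\<^esub> n. r \<otimes> x = \<zero>"
      by (auto simp: torsion_def)
    obtain r where r: "r \<in> \<mm> [^]\<^bsub>ideals_set R\<^esub> n" "r \<noteq> \<zero>"
      using pow_nonzero by blast
    then have "r \<in> carrier R" using ideal_pow_carrier by blast
    moreover from this have "x \<otimes> r = \<zero>" using n r x by (simp add: m_comm)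
    ultimately show "x \<in> \<mm>" using annihilator_of_nonzero_in_max r x by blast
  qed
  show "\<mm> \<subseteq> torsion R \<mm> (regular_module R)"
    using killed by (auto simp: torsion_def Icarr)
qed

lemma weakly_quasifair_regular: "weakly_quasifair R \<mm> (regular_module R)"
proof -
  let ?M = "regular_module R"
  obtain r where "r \<in> \<mm> [^]\<^bsub>ideals_set R\<^esub> (1::nat)" and r0: "r \<noteq> \<zero>"
    using pow_nonzero by blast
  then have r: "r \<in> \<mm>"
    using ideal_prod_inter[OF oneideal is_ideal] by auto
  have ann: "ann R N r \<subseteq> \<mm>" if "smult N = (\<otimes>)" "zero N = \<zero>" for N :: "('a, 'a) module"
    using that annihilator_of_nonzero_in_max[OF Icarr[OF r] r0] by (auto simp: ann_def)
  have "weak_Ass R (?M\<lparr>carrier := \<mm>\<rparr>) = {\<mm>}"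
    by (rule weak_Ass_eq_max[of r]) (simp_all add: r ann)
  moreover have "weak_Ass R ?M = {\<mm>}"
    by (rule weak_Ass_eq_max[of r]) (simp_all add: r Icarr ann)
  ultimately show ?thesis
    by (simp add: weakly_quasifair_def torsion_regular_eq_max Var_max)
qed

text \<open>The witness is the residue class of \<open>\<one>\<close>. Because the torsion submodule is \<open>\<mm>\<close>, this single fact
  refutes both fairness properties.\<close>

lemma ex_quotient_ann_eq_max:
  defines "Q \<equiv> quotient_module (regular_module R) \<mm>"
  shows "\<exists>x \<in> carrier Q. ann R Q x = \<mm>"
proof
  interpret M: module R "regular_module R" by (rule module_regular_module)
  let ?M = "regular_module R"
  have sub: "submodule \<mm> R ?M" by (rule submodule_regular_module[OF is_cring])
  have sg: "subgroup \<mm> (add_monoid ?M)" by (rule submodule.axioms(1)[OF sub])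
  have "\<mm> +>\<^bsub>?M\<^esub> r = \<mm> \<longleftrightarrow> r \<in> \<mm>" if "r \<in> carrier R" for r
    using M.M.a_coset_join1[of \<mm> r] M.M.a_coset_join2[of r \<mm>] sg that by auto
  moreover have "r \<odot>\<^bsub>Q\<^esub> (\<mm> +>\<^bsub>?M\<^esub> \<one>) = \<mm> +>\<^bsub>?M\<^esub> r" if "r \<in> carrier R" for r
    using M.quotient_smult[OF sub, of r \<one>] that by (simp add: Q_def)
  moreover have zero: "\<zero>\<^bsub>Q\<^esub> = \<mm>" by (simp add: Q_def quotient_module_def)
  ultimately have "r \<in> ann R Q (\<mm> +>\<^bsub>?M\<^esub> \<one>) \<longleftrightarrow> r \<in> \<mm>" if "r \<in> carrier R" for r
    using that unfolding ann_def zero by simp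
  then show "ann R Q (\<mm> +>\<^bsub>?M\<^esub> \<one>) = \<mm>"
    using a_subset by (auto simp: ann_def)
  show "\<mm> +>\<^bsub>?M\<^esub> \<one> \<in> carrier Q"
    by (auto simp: Q_def quotient_module_def A_RCOSETS_def')
qed

lemma not_fair_regular: "\<not> fair R \<mm> (regular_module R)"
proof -
  have "\<mm> \<in> Ass R (quotient_module (regular_module R) \<mm>)"
    using ex_quotient_ann_eq_max by (auto simp: Ass_def primeideal_iff_max)
  then show ?thesis by (auto simp: fair_def torsion_regular_eq_max Var_max)
qed

lemma not_weakly_fair_regular: "\<not> weakly_fair R \<mm> (regular_module R)"
proof -
  have "weak_Ass R (quotient_module (regular_module R) \<mm>) = {\<mm>}"
  proof -
    obtain x where "x \<in> carrier (quotient_module (regular_module R) \<mm>)"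
      "ann R (quotient_module (regular_module R) \<mm>) x = \<mm>"
      using ex_quotient_ann_eq_max by blast
    then show ?thesis by (rule weak_Ass_eq_max[OF _ equalityD1])
  qed
  then show ?thesis by (auto simp: weakly_fair_def torsion_regular_eq_max Var_max)
qed

end

section \<open>Sequences of power series with a common constant term\<close>

unbundle fps_syntax

text \<open>Truncation is postponed: the sequences have untruncated power series as entries, so that ring laws
  and inverses come from the type of power series.\<close>

definition ev_const_series :: "(nat \<Rightarrow> bit fps) ring"
  where "ev_const_series = \<lparr>carrier = {f. \<exists>c. (\<forall>n. f n $ 0 = c) \<and> finite {n. f n \<noteq> fps_const c}},
    mult = (\<lambda>f g n. f n * g n), one = (\<lambda>n. 1), zero = (\<lambda>n. 0), add = (\<lambda>f g n. f n + g n)\<rparr>"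

lemma ev_const_seriesI:
  assumes "\<And>n. f n $ 0 = c" "finite A" "\<And>n. n \<notin> A \<Longrightarrow> f n = fps_const c"
  shows "f \<in> carrier ev_const_series"
proof -
  have "{n. f n \<noteq> fps_const c} \<subseteq> A" using assms(3) by blast
  then have "finite {n. f n \<noteq> fps_const c}" using assms(2) finite_subset by blast
  then show ?thesis using assms(1) by (auto simp: ev_const_series_def)
qed

lemma ev_const_seriesE:
  assumes "f \<in> carrier ev_const_series"
  obtains c A where "\<forall>n. f n $ 0 = c" "finite A" "\<forall>n. n \<notin> A \<longrightarrow> f n = fps_const c"
proof -
  obtain c where "\<forall>n. f n $ 0 = c" "finite {n. f n \<noteq> fps_const c}"
    using assms by (auto simp: ev_const_series_def)
  then show thesis by (intro that[of c "{n. f n \<noteq> fps_const c}"]) auto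
qed

lemma ev_const_series_simps [simp]:
  "f \<otimes>\<^bsub>ev_const_series\<^esub> g = (\<lambda>n. f n * g n)" "\<one>\<^bsub>ev_const_series\<^esub> = (\<lambda>n. 1)"
  "\<zero>\<^bsub>ev_const_series\<^esub> = (\<lambda>n. 0)" "f \<oplus>\<^bsub>ev_const_series\<^esub> g = (\<lambda>n. f n + g n)"
  by (simp_all add: ev_const_series_def)

lemma ev_const_series_closed:
  assumes "f \<in> carrier ev_const_series" "g \<in> carrier ev_const_series"
  shows ev_const_series_mult: "(\<lambda>n. f n * g n) \<in> carrier ev_const_series"
    and ev_const_series_add: "(\<lambda>n. f n + g n) \<in> carrier ev_const_series"
proof -
  obtain c A where f: "\<forall>n. f n $ 0 = c" "finite A" "\<forall>n. n \<notin> A \<longrightarrow> f n = fps_const c"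
    using assms(1) by (rule ev_const_seriesE)
  obtain d B where g: "\<forall>n. g n $ 0 = d" "finite B" "\<forall>n. n \<notin> B \<longrightarrow> g n = fps_const d"
    using assms(2) by (rule ev_const_seriesE)
  show "(\<lambda>n. f n * g n) \<in> carrier ev_const_series"
    by (rule ev_const_seriesI[of _ "c * d" "A \<union> B"]) (simp_all add: f g)
  show "(\<lambda>n. f n + g n) \<in> carrier ev_const_series"
    by (rule ev_const_seriesI[of _ "c + d" "A \<union> B"]) (simp_all add: f g)
qed

lemma ev_const_series_comp:
  assumes "f \<in> carrier ev_const_series" "\<And>c. h (fps_const c) = fps_const (h' c)"
    "\<And>a. h a $ 0 = h' (a $ 0)"
  shows "(\<lambda>n. h (f n)) \<in> carrier ev_const_series"
proof -
  obtain c A where f: "\<forall>n. f n $ 0 = c" "finite A" "\<forall>n. n \<notin> A \<longrightarrow> f n = fps_const c"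
    using assms(1) by (rule ev_const_seriesE)
  show ?thesis
    by (rule ev_const_seriesI[of _ "h' c" A]) (simp_all add: f assms(2,3))
qed

lemma ev_const_series_uminus: "f \<in> carrier ev_const_series \<Longrightarrow> (\<lambda>n. - f n) \<in> carrier ev_const_series"
  by (rule ev_const_series_comp[where h' = uminus]) simp_all

lemma ev_const_series_inverse:
  "f \<in> carrier ev_const_series \<Longrightarrow> (\<lambda>n. inverse (f n)) \<in> carrier ev_const_series"
  by (rule ev_const_series_comp[where h' = inverse]) (simp_all add: fps_const_inverse)

lemma ev_const_series_0: "(\<lambda>n. 0) \<in> carrier ev_const_series"
  and ev_const_series_1: "(\<lambda>n. 1) \<in> carrier ev_const_series"
  using ev_const_seriesI[of "\<lambda>n. 0" 0 "{}"] ev_const_seriesI[of "\<lambda>n. 1" 1 "{}"] by simp_all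

lemma cring_ev_const_series: "cring ev_const_series"
proof (rule cringI)
  show "abelian_group ev_const_series"
  proof (rule abelian_groupI)
    fix f assume "f \<in> carrier ev_const_series"
    then show "\<exists>g\<in>carrier ev_const_series. g \<oplus>\<^bsub>ev_const_series\<^esub> f = \<zero>\<^bsub>ev_const_series\<^esub>"
      by (intro bexI[of _ "\<lambda>n. - f n"]) (simp_all add: ev_const_series_uminus)
  qed (simp_all add: ev_const_series_add ev_const_series_0 algebra_simps)
  show "Group.comm_monoid ev_const_series"
    by unfold_locales (simp_all add: ev_const_series_mult ev_const_series_1 algebra_simps)
qed (simp add: algebra_simps)

interpretation S: cring ev_const_series by (rule cring_ev_const_series)

lemma ev_const_series_a_inv:
  assumes "f \<in> carrier ev_const_series"
  shows "\<ominus>\<^bsub>ev_const_series\<^esub> f = (\<lambda>n. - f n)"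
  using assms by (intro S.minus_equality) (simp_all add: ev_const_series_uminus)

lemma ev_const_series_minus:
  assumes "g \<in> carrier ev_const_series"
  shows "f \<ominus>\<^bsub>ev_const_series\<^esub> g = (\<lambda>n. f n - g n)"
  using ev_const_series_a_inv[OF assms] by (simp add: a_minus_def)

text \<open>One family of ideals serves two purposes: \<open>vanishing Suc\<close> is the kernel of the truncation of the
  \<open>n\<close>-th entry modulo \<open>t\<^sup>n\<^sup>+\<^sup>1\<close>, and \<open>vanishing (\<lambda>n. k)\<close> maps onto an ideal containing the \<open>k\<close>-th
  power of the maximal ideal.\<close>

definition vanishing :: "(nat \<Rightarrow> nat) \<Rightarrow> (nat \<Rightarrow> bit fps) set"
  where "vanishing N = {f \<in> carrier ev_const_series. \<forall>n. \<forall>i<N n. f n $ i = 0}"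

text \<open>The set of places \<open>(n, i)\<close> with \<open>i \<le> n\<close> where the coefficient is \<open>1\<close> determines all truncated
  entries, as coefficients lie in the field with two elements. So this coding is a
  homomorphism onto its image with kernel \<open>vanishing Suc\<close>, and its image is a copy of the quotient
  ring.\<close>

definition trunc_code :: "(nat \<Rightarrow> bit fps) \<Rightarrow> nat set"
  where "trunc_code f = {prod_encode (n, i) | n i. i \<le> n \<and> f n $ i = 1}"

lemma trunc_code_mem: "prod_encode (n, i) \<in> trunc_code f \<longleftrightarrow> i \<le> n \<and> f n $ i = 1"
  by (auto simp: trunc_code_def)

lemma trunc_code_eq_iff: "trunc_code f = trunc_code g \<longleftrightarrow> (\<forall>n. \<forall>i\<le>n. f n $ i = g n $ i)"
proof
  assume eq: "trunc_code f = trunc_code g"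
  show "\<forall>n. \<forall>i\<le>n. f n $ i = g n $ i"
  proof (intro allI impI)
    fix n i :: nat assume "i \<le> n"
    then have "f n $ i = 1 \<longleftrightarrow> g n $ i = 1"
      using trunc_code_mem[of n i f] trunc_code_mem[of n i g] eq by simp
    then show "f n $ i = g n $ i" by (metis bit_not_one_iff)
  qed
qed (auto simp: trunc_code_def)

lemma fps_mult_nth_eq_0:
  fixes a b :: "'a::semiring_0 fps"
  assumes "\<And>i. i < k \<Longrightarrow> a $ i = 0" "\<And>i. i < l \<Longrightarrow> b $ i = 0" "i < k + l"
  shows "(a * b) $ i = 0"
  unfolding fps_mult_nth
proof (intro sum.neutral ballI)
  fix j assume "j \<in> {0..i}"
  then have "j < k \<or> i - j < l" using assms(3) by auto
  then show "a $ j * b $ (i - j) = 0" using assms(1,2) by auto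
qed

lemma vanishing_mult:
  assumes f: "f \<in> vanishing N" and g: "g \<in> vanishing K"
  shows "(\<lambda>n. f n * g n) \<in> vanishing (\<lambda>n. N n + K n)"
proof -
  have "(f n * g n) $ i = 0" if "i < N n + K n" for n i
    using f g by (intro fps_mult_nth_eq_0[OF _ _ that]) (auto simp: vanishing_def)
  then show ?thesis using f g by (simp add: vanishing_def ev_const_series_mult)
qed

lemma vanishing_add:
  assumes "f \<in> vanishing N" "g \<in> vanishing N"
  shows "(\<lambda>n. f n + g n) \<in> vanishing N"
  using assms by (auto simp: vanishing_def ev_const_series_add)

lemma vanishing_0: "vanishing (\<lambda>n. 0) = carrier ev_const_series"
  by (simp add: vanishing_def)

lemma ideal_vanishing: "ideal (vanishing N) ev_const_series"
proof (rule idealI)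
  show "ring ev_const_series" by (rule S.ring_axioms)
  show "subgroup (vanishing N) (add_monoid ev_const_series)"
  proof (rule S.add.subgroupI)
    fix f assume f: "f \<in> vanishing N"
    then have "\<ominus>\<^bsub>ev_const_series\<^esub> f = (\<lambda>n. - f n)"
      by (intro ev_const_series_a_inv) (simp add: vanishing_def)
    then show "\<ominus>\<^bsub>ev_const_series\<^esub> f \<in> vanishing N"
      using f by (simp add: vanishing_def ev_const_series_uminus)
  next
    show "vanishing N \<noteq> {}" using ev_const_series_0 by (auto simp: vanishing_def)
  qed (auto simp: vanishing_def ev_const_series_add)
next
  fix f g assume "f \<in> vanishing N" "g \<in> carrier ev_const_series"
  then have "(\<lambda>n. f n * g n) \<in> vanishing N"
    using vanishing_mult[of f N g "\<lambda>n. 0"] by (simp add: vanishing_0)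
  then show "f \<otimes>\<^bsub>ev_const_series\<^esub> g \<in> vanishing N" "g \<otimes>\<^bsub>ev_const_series\<^esub> f \<in> vanishing N"
    by (simp_all add: mult.commute)
qed

lemma trunc_code_weak_morphism: "weak_ring_morphism trunc_code (vanishing Suc) ev_const_series"
proof (rule weak_ring_morphismI[OF ideal_vanishing])
  fix f g assume fg: "f \<in> carrier ev_const_series" "g \<in> carrier ev_const_series"
  then have "(\<lambda>n. f n - g n) \<in> carrier ev_const_series"
    using S.minus_closed[OF fg] by (simp only: ev_const_series_minus)
  then show "trunc_code f = trunc_code g \<longleftrightarrow> f \<ominus>\<^bsub>ev_const_series\<^esub> g \<in> vanishing Suc"
    using fg
    by (auto simp only: trunc_code_eq_iff ev_const_series_minus vanishing_def less_Suc_eq_le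
        mem_Collect_eq fps_sub_nth right_minus_eq)
qed

section \<open>The ring of truncated sequences\<close>

definition trunc_ring :: "nat set ring"
  where "trunc_ring = image_ring trunc_code ev_const_series"

interpretation h: ring_hom_ring ev_const_series trunc_ring trunc_code
  unfolding trunc_ring_def by (rule S.weak_ring_morphism_ring_hom[OF trunc_code_weak_morphism])

lemma carrier_trunc_ring: "carrier trunc_ring = trunc_code ` carrier ev_const_series"
  by (simp add: trunc_ring_def image_ring_carrier)

lemma trunc_code_mult:
  assumes "f \<in> carrier ev_const_series" "g \<in> carrier ev_const_series"
  shows "trunc_code f \<otimes>\<^bsub>trunc_ring\<^esub> trunc_code g = trunc_code (\<lambda>n. f n * g n)"
  using h.hom_mult[OF assms] by simp

lemma trunc_code_add:
  assumes "f \<in> carrier ev_const_series" "g \<in> carrier ev_const_series"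
  shows "trunc_code f \<oplus>\<^bsub>trunc_ring\<^esub> trunc_code g = trunc_code (\<lambda>n. f n + g n)"
  using h.hom_add[OF assms] by simp

lemma trunc_ring_zero_one:
  "\<zero>\<^bsub>trunc_ring\<^esub> = trunc_code (\<lambda>n. 0)" "\<one>\<^bsub>trunc_ring\<^esub> = trunc_code (\<lambda>n. 1)"
  using h.hom_zero h.hom_one by simp_all

lemma cring_trunc_ring: "cring trunc_ring"
proof -
  have "x \<otimes>\<^bsub>trunc_ring\<^esub> y = y \<otimes>\<^bsub>trunc_ring\<^esub> x"
    if "x \<in> carrier trunc_ring" "y \<in> carrier trunc_ring" for x y
    using that by (auto simp: carrier_trunc_ring trunc_code_mult mult.commute)
  then show ?thesis by unfold_locales
qed

definition trunc_max :: "nat set set"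
  where "trunc_max = trunc_code ` vanishing (\<lambda>n. 1)"

lemma trunc_code_mem_max_iff:
  assumes "f \<in> carrier ev_const_series"
  shows "trunc_code f \<in> trunc_max \<longleftrightarrow> f 0 $ 0 = 0"
proof
  assume "trunc_code f \<in> trunc_max"
  then obtain g where "trunc_code f = trunc_code g" "g \<in> vanishing (\<lambda>n. 1)"
    by (auto simp: trunc_max_def)
  then show "f 0 $ 0 = 0" by (simp add: trunc_code_eq_iff vanishing_def)
next
  assume "f 0 $ 0 = 0"
  then have "f n $ 0 = 0" for n using assms by (metis ev_const_seriesE)
  then have "f \<in> vanishing (\<lambda>n. 1)" using assms by (simp add: vanishing_def)
  then show "trunc_code f \<in> trunc_max" by (auto simp: trunc_max_def)
qed

lemma ideal_trunc_max: "ideal trunc_max trunc_ring"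
proof -
  interpret I: ideal "vanishing (\<lambda>n. 1)" ev_const_series by (rule ideal_vanishing)
  show ?thesis
  proof (rule idealI)
    show "ring trunc_ring" by (rule h.S.ring_axioms)
    show "subgroup trunc_max (add_monoid trunc_ring)"
      using h.a_group_hom group_hom.subgroup_img_is_subgroup[OF _ I.a_subgroup]
      unfolding trunc_max_def by blast
  next
    fix a x assume "a \<in> trunc_max" "x \<in> carrier trunc_ring"
    then obtain f g where fg: "a = trunc_code f" "f \<in> vanishing (\<lambda>n. 1)"
      "x = trunc_code g" "g \<in> carrier ev_const_series"
      by (auto simp: trunc_max_def carrier_trunc_ring)
    then have "x \<otimes>\<^bsub>trunc_ring\<^esub> a = trunc_code (g \<otimes>\<^bsub>ev_const_series\<^esub> f)"
      "a \<otimes>\<^bsub>trunc_ring\<^esub> x = trunc_code (f \<otimes>\<^bsub>ev_const_series\<^esub> g)"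
      by (simp_all add: trunc_code_mult I.Icarr)
    then show "x \<otimes>\<^bsub>trunc_ring\<^esub> a \<in> trunc_max" "a \<otimes>\<^bsub>trunc_ring\<^esub> x \<in> trunc_max"
      using I.I_l_closed[OF fg(2,4)] I.I_r_closed[OF fg(2,4)] unfolding trunc_max_def by blast+
  qed
qed

lemma trunc_max_pow_subset:
  "trunc_max [^]\<^bsub>ideals_set trunc_ring\<^esub> k \<subseteq> trunc_code ` vanishing (\<lambda>n. k)"
proof (induction k)
  case 0
  then show ?case by (simp add: vanishing_0 carrier_trunc_ring)
next
  case (Suc k)
  have "x \<in> trunc_code ` vanishing (\<lambda>n. Suc k)"
    if "x \<in> ideal_prod trunc_ring (trunc_max [^]\<^bsub>ideals_set trunc_ring\<^esub> k) trunc_max" for x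
    using that
  proof (induction rule: ideal_prod.induct)
    case (prod i j)
    then obtain f g where fg: "i = trunc_code f" "f \<in> vanishing (\<lambda>n. k)"
      "j = trunc_code g" "g \<in> vanishing (\<lambda>n. 1)"
      using Suc.IH by (auto simp: trunc_max_def)
    then have "i \<otimes>\<^bsub>trunc_ring\<^esub> j = trunc_code (\<lambda>n. f n * g n)"
      by (simp add: trunc_code_mult vanishing_def)
    moreover have "(\<lambda>n. f n * g n) \<in> vanishing (\<lambda>n. Suc k)"
      using vanishing_mult[OF fg(2,4)] by simp
    ultimately show ?case by blast
  next
    case (sum i j)
    then obtain f g where fg: "i = trunc_code f" "f \<in> vanishing (\<lambda>n. Suc k)"
      "j = trunc_code g" "g \<in> vanishing (\<lambda>n. Suc k)"
      by auto
    then have "i \<oplus>\<^bsub>trunc_ring\<^esub> j = trunc_code (\<lambda>n. f n + g n)"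
      by (simp add: trunc_code_add vanishing_def)
    then show ?case using vanishing_add[OF fg(2,4)] by blast
  qed
  then show ?case by auto
qed

text \<open>If the entries of \<open>x\<close> are zero at all indices \<open>\<ge> k\<close>, then \<open>\<mm>\<^sup>k\<close> kills \<open>x\<close>: its elements are
  divisible by \<open>t\<^sup>k\<close> in each entry, which is zero modulo \<open>t\<^sup>n\<^sup>+\<^sup>1\<close> for \<open>n < k\<close>.\<close>

lemma trunc_max_killed:
  assumes "x \<in> trunc_max"
  shows "\<exists>k::nat. \<forall>r \<in> trunc_max [^]\<^bsub>ideals_set trunc_ring\<^esub> k. r \<otimes>\<^bsub>trunc_ring\<^esub> x = \<zero>\<^bsub>trunc_ring\<^esub>"
proof -
  obtain f where x: "x = trunc_code f" and f: "f \<in> carrier ev_const_series"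
    and f0: "\<And>n. f n $ 0 = 0"
    using assms unfolding trunc_max_def vanishing_def by force
  obtain c A where fA: "\<forall>n. f n $ 0 = c" "finite A" "\<forall>n. n \<notin> A \<longrightarrow> f n = fps_const c"
    using f by (rule ev_const_seriesE)
  have "c = 0" using fA(1) f0 by simp
  obtain k where k: "\<And>n. n \<in> A \<Longrightarrow> n < k"
    using fA(2) by (auto simp: finite_nat_set_iff_bounded)
  have "r \<otimes>\<^bsub>trunc_ring\<^esub> x = \<zero>\<^bsub>trunc_ring\<^esub>"
    if mem: "r \<in> trunc_max [^]\<^bsub>ideals_set trunc_ring\<^esub> k" for r
  proof -
    obtain g where r: "r = trunc_code g" and g: "g \<in> vanishing (\<lambda>n. k)"
      using subsetD[OF trunc_max_pow_subset mem] by blast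
    have "(g n * f n) $ i = 0" if "i \<le> n" for n i
    proof (cases "n \<in> A")
      case True
      then have "i < k" using k that by fastforce
      then show ?thesis
        using g fps_mult_nth_eq_0[of k "g n" 0 "f n" i] by (simp add: vanishing_def)
    next
      case False
      then show ?thesis using fA(3) \<open>c = 0\<close> by simp
    qed
    then have "trunc_code (\<lambda>n. g n * f n) = trunc_code (\<lambda>n. 0)"
      by (simp add: trunc_code_eq_iff)
    then show ?thesis
      using f g by (simp add: x r trunc_code_mult trunc_ring_zero_one vanishing_def)
  qed
  then show ?thesis by blast
qed

text \<open>For \<open>k > 0\<close> these sequences lie in the ring, and those with \<open>k \<le> m\<close> survive truncation. They
  witness that no power of the maximal ideal vanishes.\<close>

definition single_power :: "nat \<Rightarrow> nat \<Rightarrow> nat \<Rightarrow> bit fps"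
  where "single_power m k = (\<lambda>n. if n = m then fps_X ^ k else 0)"

lemma single_power_carrier: "single_power m (Suc k) \<in> carrier ev_const_series"
  by (rule ev_const_seriesI[of _ 0 "{m}"]) (auto simp: single_power_def)

lemma single_power_mem_pow:
  "trunc_code (single_power m (Suc k)) \<in> trunc_max [^]\<^bsub>ideals_set trunc_ring\<^esub> Suc k"
proof (induction k)
  have max: "trunc_code (single_power m 1) \<in> trunc_max"
    using trunc_code_mem_max_iff[OF single_power_carrier[of m 0]] by (simp add: single_power_def)
  {
    case 0
    have "\<one>\<^bsub>trunc_ring\<^esub> \<otimes>\<^bsub>trunc_ring\<^esub> trunc_code (single_power m 1)
        \<in> ideal_prod trunc_ring (carrier trunc_ring) trunc_max"
      by (rule ideal_prod.prod) (simp_all add: max[simplified])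
    then show ?case using single_power_carrier[of m 0] by simp
  next
    case (Suc k)
    have "(\<lambda>n. single_power m (Suc k) n * single_power m 1 n) = single_power m (Suc (Suc k))"
      by (auto simp: single_power_def)
    then have "trunc_code (single_power m (Suc (Suc k))) =
        trunc_code (single_power m (Suc k)) \<otimes>\<^bsub>trunc_ring\<^esub> trunc_code (single_power m 1)"
      using trunc_code_mult[OF single_power_carrier[of m k] single_power_carrier[of m 0]] by simp
    then show ?case
      using ideal_prod.prod[OF Suc.IH max, of trunc_ring] by simp
  }
qed

lemma trunc_max_pow_nonzero:
  "\<exists>r \<in> trunc_max [^]\<^bsub>ideals_set trunc_ring\<^esub> (k::nat). r \<noteq> \<zero>\<^bsub>trunc_ring\<^esub>"
proof (cases k)
  case 0
  have "\<one>\<^bsub>trunc_ring\<^esub> \<noteq> \<zero>\<^bsub>trunc_ring\<^esub>"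
    by (auto simp: trunc_ring_zero_one trunc_code_eq_iff simp del: h.hom_zero h.hom_one)
  then show ?thesis using 0 by (auto intro: bexI[of _ "\<one>\<^bsub>trunc_ring\<^esub>"])
next
  case (Suc j)
  \<comment> \<open>Truncation of the entry of index \<open>k\<close> keeps exactly the coefficients up to degree \<open>k\<close>.\<close>
  have "trunc_code (single_power k k) \<noteq> \<zero>\<^bsub>trunc_ring\<^esub>"
  proof
    assume "trunc_code (single_power k k) = \<zero>\<^bsub>trunc_ring\<^esub>"
    then have "single_power k k k $ k = 0"
      unfolding trunc_ring_zero_one trunc_code_eq_iff by simp
    then show False by (simp add: single_power_def)
  qed
  then show ?thesis using single_power_mem_pow[of k j] Suc by blast
qed

text \<open>Outside the maximal ideal all entries have nonzero constant term, so the inverse can be formed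
  entrywise, and it is again constant in almost all entries.\<close>

lemma trunc_ring_unit:
  assumes "x \<in> carrier trunc_ring" "x \<notin> trunc_max"
  shows "x \<in> Units trunc_ring"
proof -
  obtain f where x: "x = trunc_code f" and f: "f \<in> carrier ev_const_series"
    using assms(1) by (auto simp: carrier_trunc_ring)
  have "f 0 $ 0 \<noteq> 0" using assms(2) trunc_code_mem_max_iff[OF f] x by simp
  then have "f n $ 0 \<noteq> 0" for n using f by (metis ev_const_seriesE)
  then have "inverse (f n) * f n = 1" for n by (simp add: inverse_mult_eq_1)
  then have "trunc_code (\<lambda>n. inverse (f n)) \<otimes>\<^bsub>trunc_ring\<^esub> x = \<one>\<^bsub>trunc_ring\<^esub>"
    "x \<otimes>\<^bsub>trunc_ring\<^esub> trunc_code (\<lambda>n. inverse (f n)) = \<one>\<^bsub>trunc_ring\<^esub>"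
    using f ev_const_series_inverse[OF f]
    by (simp_all add: x trunc_code_mult trunc_ring_zero_one mult.commute)
  then show ?thesis
    using assms(1) ev_const_series_inverse[OF f]
    by (auto simp: Units_def carrier_trunc_ring intro!: bexI)
qed

lemma unbounded_torsion_trunc_ring: "unbounded_torsion_local_ring trunc_ring trunc_max"
proof (intro unbounded_torsion_local_ring.intro unbounded_torsion_local_ring_axioms.intro)
  show "\<one>\<^bsub>trunc_ring\<^esub> \<notin> trunc_max"
    using trunc_code_mem_max_iff[OF ev_const_series_1] by (simp add: trunc_ring_zero_one)
qed (simp_all add: cring_trunc_ring ideal_trunc_max trunc_ring_unit trunc_max_killed
      trunc_max_pow_nonzero)

theorem mainTheorem4:
  shows "\<exists>(R :: nat set ring) (\<aa> :: nat set set) (M :: (nat set, nat set) module).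
    cring R \<and> ideal \<aa> R \<and> module R M \<and>
    weakly_quasifair R \<aa> M \<and> \<not> fair R \<aa> M \<and> \<not> weakly_fair R \<aa> M"
proof -
  interpret L: unbounded_torsion_local_ring trunc_ring trunc_max
    by (rule unbounded_torsion_trunc_ring)
  show ?thesis
    using cring_trunc_ring ideal_trunc_max cring.module_regular_module[OF cring_trunc_ring]
      L.weakly_quasifair_regular L.not_fair_regular L.not_weakly_fair_regular
    by (intro exI conjI)
qed

end
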